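(* Let $\mathbb{G}$ be a risk-averse game with incomplete information. Suppose that each ex ante risk preference $\rho^i\in\mathcal{R}$ is a law-invariant coherent risk measure. Let $\beta\in\Sigma$ and, for each player $i\in\mathcal{I}$, let $Z^i_{\tau,\beta}$ be an $\mathcal{F}^i_\tau$-measurable dual variable admissible for $\rho^i$, and let the revised interim risk preference of player $i$ be the extended conditional risk functional $\rho^i_{Z^i_{\tau,\beta}}(\cdot|\mathcal{F}^i_\tau)$ associated with $\rho^i$ and $Z^i_{\tau,\beta}$. Then, with $Z_{\tau,\beta}=\{Z^1_{\tau,\beta},\dots,Z^I_{\tau,\beta}\}$, a $Z_{\tau,\beta}$-revised Bayesian Nash equilibrium exists in $\mathbb{G}$.
   Context: Game. $\mathcal{I}=\{1,\dots,I\}$, $I\ge2$, is a finite set of players. Each player $i$ has a non-empty finite set of types $T_i$ and a non-empty finite set of actions $A_i$; $T=\prod_i T_i$, $A=\prod_i A_i$. $\mathcal{F}$ is the $\sigma$-algebra of all subsets of $T$, and $P$ is a fully supported probability measure on $(T,\mathcal{F})$ (the common prior); $\mathbb{E}$ is expectation under $P$. Player $i$ has a bounded loss function $l^i:T\times A\to\mathbb{R}$; players minimize losses. $\mathcal{R}=\{\rho^1,\dots,\rho^I\}$, $\rho^i:\mathcal{L}^\infty(T,\mathcal{F},P)\to\mathbb{R}$, is the ex ante risk preference profile. The interim information of player $i$ is the sub-$\sigma$-algebra $\mathcal{F}^i_\tau\subset\mathcal{F}$ generated by the cells $\{t\in T:\text{the } i\text{-th coordinate of } t\text{ is } t_i\}$,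 $t_i\in T_i$. Strategies. A (mixed/behavioral) strategy of player $i$ is a map $\beta_i:T_i\to\Delta(A_i)$, where $\Delta(A_i)$ is the set of probability distributions on $A_i$; $\Sigma_i$ is the set of these and $\Sigma=\prod_i\Sigma_i$. For $\beta\in\Sigma$, $(a_i,\beta_{-i})$ is the profile in which player $i$ plays the pure action $a_i\in A_i$ and the others play as in $\beta$. Random loss: $L^i_\beta(t)=\sum_{a\in A}l^i(t,a)\prod_{j\in\mathcal{I}}\beta_j(a_j|t_j)$, a random variable on $T$. Risk measures. $\rho:\mathcal{L}^\infty(T,\mathcal{F},P)\to\mathbb{R}$ is a coherent risk measure if it satisfies: monotonicity ($\rho(L_1)\le\rho(L_2)$ if $L_1\le L_2$ a.s.); convexity ($\rho((1-\alpha)L_1+\alpha L_2)\le(1-\alpha)\rho(L_1)+\alpha\rho(L_2)$, $0\le\alpha\le1$); translation invariance ($\rho(L+c)=\rho(L)+c$, $c\in\mathbb{R}$); positive homogeneity ($\rho(\alpha L)=\alpha\rho(L)$, $\alpha>0$). It is law-invariant if $\rho(L_1)=\rho(L_2)$ whenever $L_1,L_2$ have the same distribution under $P$. Extended conditional risk functional. Let $\rho$ be a law-invariant coherent risk measure and $\mathcal{F}_\tau\subset\mathcal{F}$ a sub-$\sigma$-algebra. An $\mathcal{F}_\tau$-measurable $Z_\tau$ is an admissible dual variable if $Z_\tau\ge0$, $\mathbb{E}(Z_\tau)=1$ and $\mathbb{E}(LZ_\tau)\le\rho(L)$ for all $L\in\mathcal{L}^\infty(T,\mathcal{F},P)$.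 For such $Z_\tau$, $$\rho_{Z_\tau}(L|\mathcal{F}_\tau)=\operatorname{ess\,sup}\{\mathbb{E}(LZ'|\mathcal{F}_\tau): Z'\in\mathfrak{M}_{Z_\tau}\},$$ $$\mathfrak{M}_{Z_\tau}=\{Z'\in\mathcal{L}^1(T,\mathcal{F},P):\ \mathbb{E}(Z'|\mathcal{F}_\tau)=1,\ Z'\ge0,\ \mathbb{E}(L'Z_\tau Z')\le\rho(L')\ \forall L'\in\mathcal{L}^\infty(T,\mathcal{F},P)\}.$$ For player $i$, $\rho^i_{Z^i_\beta(t_i)}(L|t_i)$ denotes the value of $\rho^i_{Z^i_{\tau,\beta}}(L|\mathcal{F}^i_\tau)$ on the cell of $t_i$. Risk-revised equilibrium. Given $Z_{\tau,\beta}$, a profile $\beta^*\in\Sigma$ is a $Z_{\tau,\beta}$-revised Bayesian Nash equilibrium if for each $i\in\mathcal{I}$, $t_i\in T_i$, $a_i\in A_i$, $$\rho^i_{Z^i_\beta(t_i)}(L^i_{\beta^*}|t_i)\le\rho^i_{Z^i_\beta(t_i)}(L^i_{(a_i,\beta^*_{-i})}|t_i).$$ *)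

theory Defs
  imports "HOL-Probability.Probability"
begin

section \<open>Risk measures\<close>

text \<open>Elements of \<open>L\<^sup>\<infinity>\<close> are represented by functions; monotonicity below is almost sure, so a
  coherent risk measure does not distinguish functions that agree almost surely.\<close>

definition Linf :: "'w measure \<Rightarrow> ('w \<Rightarrow> real) set" where
  "Linf M = {L \<in> borel_measurable M. \<exists>C. AE x in M. \<bar>L x\<bar> \<le> C}"

definition coherent_risk_measure :: "'w measure \<Rightarrow> (('w \<Rightarrow> real) \<Rightarrow> real) \<Rightarrow> bool" where
  "coherent_risk_measure M \<rho> \<longleftrightarrow>
     (\<forall>L1\<in>Linf M. \<forall>L2\<in>Linf M. (AE x in M. L1 x \<le> L2 x) \<longrightarrow> \<rho> L1 \<le> \<rho> L2) \<and>
     (\<forall>L1\<in>Linf M. \<forall>L2\<in>Linf M. \<forall>\<alpha>\<in>{0..1}.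
        \<rho> (\<lambda>x. (1 - \<alpha>) * L1 x + \<alpha> * L2 x) \<le> (1 - \<alpha>) * \<rho> L1 + \<alpha> * \<rho> L2) \<and>
     (\<forall>L\<in>Linf M. \<forall>c. \<rho> (\<lambda>x. L x + c) = \<rho> L + c) \<and>
     (\<forall>L\<in>Linf M. \<forall>\<alpha>>0. \<rho> (\<lambda>x. \<alpha> * L x) = \<alpha> * \<rho> L)"

definition law_invariant :: "'w measure \<Rightarrow> (('w \<Rightarrow> real) \<Rightarrow> real) \<Rightarrow> bool" where
  "law_invariant M \<rho> \<longleftrightarrow>
     (\<forall>L1\<in>Linf M. \<forall>L2\<in>Linf M. distr M borel L1 = distr M borel L2 \<longrightarrow> \<rho> L1 = \<rho> L2)"


section \<open>Extended conditional risk functionals\<close>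

text \<open>In this section \<open>F\<close> is a subalgebra of \<open>M\<close>; only its space and its measurable sets are used.\<close>

definition admissible_dual ::
    "'w measure \<Rightarrow> 'w measure \<Rightarrow> (('w \<Rightarrow> real) \<Rightarrow> real) \<Rightarrow> ('w \<Rightarrow> real) \<Rightarrow> bool" where
  "admissible_dual M F \<rho> Z \<longleftrightarrow>
     Z \<in> borel_measurable F \<and> (AE x in M. 0 \<le> Z x) \<and> (\<integral>x. Z x \<partial>M) = 1 \<and>
     (\<forall>L\<in>Linf M. (\<integral>x. L x * Z x \<partial>M) \<le> \<rho> L)"

definition dual_set ::
    "'w measure \<Rightarrow> 'w measure \<Rightarrow> (('w \<Rightarrow> real) \<Rightarrow> real) \<Rightarrow> ('w \<Rightarrow> real) \<Rightarrow> ('w \<Rightarrow> real) set" where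
  "dual_set M F \<rho> Z =
     {Z'. integrable M Z' \<and> (AE x in M. real_cond_exp M F Z' x = 1) \<and> (AE x in M. 0 \<le> Z' x) \<and>
          (\<forall>L\<in>Linf M. (\<integral>x. L x * Z x * Z' x \<partial>M) \<le> \<rho> L)}"

definition is_ess_sup :: "'w measure \<Rightarrow> ('w \<Rightarrow> real) set \<Rightarrow> ('w \<Rightarrow> real) \<Rightarrow> bool" where
  "is_ess_sup M \<X> Y \<longleftrightarrow>
     Y \<in> borel_measurable M \<and> (\<forall>X\<in>\<X>. AE x in M. X x \<le> Y x) \<and>
     (\<forall>W\<in>borel_measurable M. (\<forall>X\<in>\<X>. AE x in M. X x \<le> W x) \<longrightarrow> (AE x in M. Y x \<le> W x))"

text \<open>The essential supremum is unique up to null sets, and the functional below takes an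
  \<open>F\<close>-measurable version of it. For \<open>Z\<close> admissible and \<open>L\<close> in \<open>L\<^sup>\<infinity>\<close> a real-valued version
  exists: the family contains the value for \<open>Z' = 1\<close>, and its members are bounded by a common
  constant.\<close>

definition ext_cond_risk ::
    "'w measure \<Rightarrow> 'w measure \<Rightarrow> (('w \<Rightarrow> real) \<Rightarrow> real) \<Rightarrow> ('w \<Rightarrow> real) \<Rightarrow> ('w \<Rightarrow> real) \<Rightarrow> 'w \<Rightarrow> real"
  where
  "ext_cond_risk M F \<rho> Z L =
     (SOME Y. Y \<in> borel_measurable F \<and>
        is_ess_sup M {real_cond_exp M F (\<lambda>x. L x * Z' x) | Z'. Z' \<in> dual_set M F \<rho> Z} Y)"


section \<open>Risk-averse games with incomplete information\<close>

record ('t, 'a) game =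
  num_players :: nat
  types :: "nat \<Rightarrow> 't set"
  actions :: "nat \<Rightarrow> 'a set"
  prior :: "(nat \<Rightarrow> 't) measure"
  loss :: "nat \<Rightarrow> (nat \<Rightarrow> 't) \<Rightarrow> (nat \<Rightarrow> 'a) \<Rightarrow> real"
  risk_pref :: "nat \<Rightarrow> ((nat \<Rightarrow> 't) \<Rightarrow> real) \<Rightarrow> real"

definition players :: "('t, 'a) game \<Rightarrow> nat set" where
  "players G = {1..num_players G}"

definition type_profiles :: "('t, 'a) game \<Rightarrow> (nat \<Rightarrow> 't) set" where
  "type_profiles G = PiE (players G) (types G)"

definition action_profiles :: "('t, 'a) game \<Rightarrow> (nat \<Rightarrow> 'a) set" where
  "action_profiles G = PiE (players G) (actions G)"

definition risk_averse_game :: "('t, 'a) game \<Rightarrow> bool" where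
  "risk_averse_game G \<longleftrightarrow>
     num_players G \<ge> 2 \<and>
     (\<forall>i\<in>players G. finite (types G i) \<and> types G i \<noteq> {} \<and>
                     finite (actions G i) \<and> actions G i \<noteq> {}) \<and>
     prob_space (prior G) \<and>
     space (prior G) = type_profiles G \<and>
     sets (prior G) = Pow (type_profiles G) \<and>
     (\<forall>t\<in>type_profiles G. measure (prior G) {t} > 0) \<and>
     (\<forall>i\<in>players G. \<exists>C. \<forall>t\<in>type_profiles G. \<forall>a\<in>action_profiles G. \<bar>loss G i t a\<bar> \<le> C)"

definition interim_info :: "('t, 'a) game \<Rightarrow> nat \<Rightarrow> (nat \<Rightarrow> 't) measure" where
  "interim_info G i =
     sigma (type_profiles G) {{t \<in> type_profiles G. t i = ti} | ti. ti \<in> types G i}"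

type_synonym ('t, 'a) profile = "nat \<Rightarrow> 't \<Rightarrow> 'a pmf"

definition strategies :: "('t, 'a) game \<Rightarrow> nat \<Rightarrow> ('t \<Rightarrow> 'a pmf) set" where
  "strategies G i = PiE (types G i) (\<lambda>_. {p. set_pmf p \<subseteq> actions G i})"

definition strategy_profiles :: "('t, 'a) game \<Rightarrow> ('t, 'a) profile set" where
  "strategy_profiles G = PiE (players G) (strategies G)"

definition deviate :: "('t, 'a) game \<Rightarrow> nat \<Rightarrow> 'a \<Rightarrow> ('t, 'a) profile \<Rightarrow> ('t, 'a) profile" where
  "deviate G i a \<beta> = \<beta>(i := (\<lambda>ti\<in>types G i. return_pmf a))"

definition random_loss ::
    "('t, 'a) game \<Rightarrow> nat \<Rightarrow> ('t, 'a) profile \<Rightarrow> (nat \<Rightarrow> 't) \<Rightarrow> real" where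
  "random_loss G i \<beta> t =
     (\<Sum>a\<in>action_profiles G. loss G i t a * (\<Prod>j\<in>players G. pmf (\<beta> j (t j)) (a j)))"

text \<open>The constant value on the cell of \<open>ti\<close> of player \<open>i\<close>'s revised interim risk preference
  for the dual variable \<open>Z\<close>.\<close>

definition interim_risk ::
    "('t, 'a) game \<Rightarrow> nat \<Rightarrow> ((nat \<Rightarrow> 't) \<Rightarrow> real) \<Rightarrow> ((nat \<Rightarrow> 't) \<Rightarrow> real) \<Rightarrow> 't \<Rightarrow> real" where
  "interim_risk G i Z L ti =
     (THE r. \<forall>t\<in>type_profiles G. t i = ti \<longrightarrow>
        ext_cond_risk (prior G) (interim_info G i) (risk_pref G i) Z L t = r)"

definition revised_equilibrium ::
    "('t, 'a) game \<Rightarrow> (nat \<Rightarrow> (nat \<Rightarrow> 't) \<Rightarrow> real) \<Rightarrow> ('t, 'a) profile \<Rightarrow> bool" where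
  "revised_equilibrium G Z \<beta> \<longleftrightarrow>
     \<beta> \<in> strategy_profiles G \<and>
     (\<forall>i\<in>players G. \<forall>ti\<in>types G i. \<forall>a\<in>actions G i.
        interim_risk G i (Z i) (random_loss G i \<beta>) ti
          \<le> interim_risk G i (Z i) (random_loss G i (deviate G i a \<beta>)) ti)"

end

theory Submission imports Defs begin

text \<open>On a cell of player \<open>i\<close>'s interim information, the revised risk preference is a supremum of
  means over a non-empty set of probability weights on that cell, since \<open>Z' = 1\<close> is always an
  admissible dual density. Hence it is convex, continuous, and depends only on the values of the
  loss on the cell. Summing over players and types gives \<open>F x y\<close>, the total risk when each player
  switches from \<open>x\<close> to \<open>y\<close> on their own; it is continuous, and convex in \<open>y\<close>. A strategy profile
  \<open>x\<close> minimizing \<open>F x\<close> is an equilibrium, because \<open>F\<close> separates over the types of the players. It is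
  found as a fixed point of the map sending \<open>x\<close> to the unique minimizer of
  \<open>F x y + \<bar>x - y\<bar>\<^sup>2\<close>: single-valuedness allows Brouwer's theorem instead of Kakutani's, and at a
  fixed point the quadratic term is of second order along segments, so convexity removes it.\<close>

section \<open>Brouwer's theorem on a cube with finitely many coordinates\<close>

text \<open>The library's Brouwer theorem concerns Euclidean space types, whose dimension cannot depend on
  the game. Kuhn's lemma is indexed by \<open>nat\<close>, so the theorem is derived from it for
  \<open>I \<rightarrow>\<^sub>E {0..1}\<close> with an arbitrary finite index set.\<close>

lemma tendsto_fun_iff:
  fixes f :: "'c \<Rightarrow> 'i \<Rightarrow> 'b :: topological_space"
  shows "(f \<longlongrightarrow> l) F \<longleftrightarrow> (\<forall>i. ((\<lambda>c. f c i) \<longlongrightarrow> l i) F)"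
  using limitin_componentwise[of "\<lambda>_. euclidean" UNIV f l F]
  by (simp add: euclidean_product_topology)

text \<open>Tychonoff's theorem: outside \<open>I\<close>, extensionality pins each coordinate to
  \<open>undefined\<close>, which is again a compact factor.\<close>

lemma compact_PiE:
  fixes S :: "'i \<Rightarrow> 'b :: topological_space set"
  assumes "\<And>i. i \<in> I \<Longrightarrow> compact (S i)"
  shows "compact (PiE I S)"
proof -
  have eq: "PiE I S = PiE UNIV (\<lambda>i. if i \<in> I then S i else {undefined})"
    by (auto simp: PiE_iff extensional_def split: if_splits)
  show ?thesis
    unfolding eq compactin_euclidean_iff[symmetric] euclidean_product_topology[symmetric]
      compactin_PiE
    using assms by (auto simp: compactin_euclidean_iff)
qed

text \<open>Kuhn's combinatorial lemma on the grid of mesh \<open>1 / p\<close>: near a corner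
  \<open>c\<close> of some grid cell, every coordinate of \<open>f x - x\<close> weakly changes
  sign. The pair \<open>a\<close>, \<open>b\<close> may depend on the coordinate, but
  \<open>c\<close> does not.\<close>

lemma kuhn_sign_change:
  fixes f :: "('i \<Rightarrow> real) \<Rightarrow> 'i \<Rightarrow> real" and p :: nat
  defines "C I \<equiv> PiE I (\<lambda>_. {0..1})"
  assumes "finite I" and f: "\<And>x. x \<in> C I \<Longrightarrow> f x \<in> C I" and "p > 0"
  shows "\<exists>c\<in>C I. \<forall>i\<in>I. \<exists>a\<in>C I. \<exists>b\<in>C I.
           (\<forall>j\<in>I. \<bar>a j - c j\<bar> \<le> 1 / p \<and> \<bar>b j - c j\<bar> \<le> 1 / p) \<and> f a i \<le> a i \<and> b i \<le> f b i"
proof -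
  obtain h where h: "bij_betw h {0..<card I} I"
    using ex_bij_betw_nat_finite[OF \<open>finite I\<close>] by blast
  define n where "n = card I"
  define g where "g = inv_into {0..<n} h"
  have g: "bij_betw g I {0..<n}"
    unfolding g_def n_def by (rule bij_betw_inv_into[OF h])
  have hg: "h (g i) = i" "g i < n" if "i \<in> I" for i
    using bij_betw_inv_into_right[OF h that] bij_betwE[OF g] that by (simp_all add: g_def n_def)
  have gh: "g (h k) = k" "h k \<in> I" if "k < n" for k
    using bij_betw_inv_into_left[OF h, of k] bij_betwE[OF h] that by (simp_all add: g_def n_def)
  define P where "P v = (\<lambda>j\<in>I. real (v (g j)) / real p)" for v :: "nat \<Rightarrow> nat"
  have PC: "P v \<in> C I" if "\<forall>k<n. v k \<le> p" for v
    using that hg \<open>p > 0\<close> by (auto simp: P_def C_def divide_simps)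
  \<comment> \<open>Label 1 marks coordinates that \<open>f\<close> does not increase, label 0 those
    that it does not decrease. Kuhn's lemma prescribes the labels on the faces; there the
    inequalities hold because \<open>f\<close> maps into the cube.\<close>
  define label where
    "label v k = (if v k \<noteq> 0 \<and> (v k = p \<or> f (P v) (h k) < P v (h k)) then 1 else 0::nat)" for v k
  have label01: "label v k = 0 \<or> label v k = 1" for v k
    by (simp add: label_def)
  have l1: "f (P v) (h k) \<le> P v (h k)" if "\<forall>k<n. v k \<le> p" "label v k = 1" "k < n" for v k
  proof -
    have "f (P v) (h k) \<le> 1"
      using PiE_mem[OF f[OF PC[OF that(1)], unfolded C_def] gh(2)[OF that(3)]] by simp
    moreover have "P v (h k) = 1" if "v k = p"
      using that \<open>k < n\<close> \<open>p > 0\<close> gh by (simp add: P_def)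
    ultimately show ?thesis
      using that(2) unfolding label_def by (cases "v k = p") (simp_all split: if_splits)
  qed
  have l0: "P v (h k) \<le> f (P v) (h k)" if "\<forall>k<n. v k \<le> p" "label v k = 0" "k < n" for v k
  proof -
    have "f (P v) (h k) \<ge> 0"
      using PiE_mem[OF f[OF PC[OF that(1)], unfolded C_def] gh(2)[OF that(3)]] by simp
    moreover have "P v (h k) = 0" if "v k = 0"
      using that \<open>k < n\<close> gh by (simp add: P_def)
    ultimately show ?thesis
      using that(2) unfolding label_def by (cases "v k = 0") (simp_all split: if_splits)
  qed
  obtain q where q: "\<forall>i<n. q i < p"
    and rs: "\<forall>i<n. \<exists>r s. (\<forall>j<n. q j \<le> r j \<and> r j \<le> q j + 1) \<and>
               (\<forall>j<n. q j \<le> s j \<and> s j \<le> q j + 1) \<and> label r i \<noteq> label s i"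
    by (rule kuhn_lemma[OF \<open>p > 0\<close>, of n label])
      (use \<open>p > 0\<close> in \<open>simp_all add: label_def\<close>)
  have near: "\<bar>P v j - P q j\<bar> \<le> 1 / p" if "\<forall>j<n. q j \<le> v j \<and> v j \<le> q j + 1" "j \<in> I" for v j
  proof -
    have "\<bar>real (v (g j)) - real (q (g j))\<bar> \<le> 1"
      using that(1)[rule_format, OF hg(2)[OF that(2)]] by linarith
    then show ?thesis using that \<open>p > 0\<close>
      by (simp add: P_def abs_divide divide_right_mono diff_divide_distrib[symmetric])
  qed
  have *: "\<exists>a\<in>C I. \<exists>b\<in>C I. (\<forall>j\<in>I. \<bar>a j - P q j\<bar> \<le> 1 / p \<and> \<bar>b j - P q j\<bar> \<le> 1 / p) \<and>
      f a i \<le> a i \<and> b i \<le> f b i" if i: "i \<in> I" for i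
  proof -
    define k where "k = g i"
    have k: "k < n" "h k = i" using hg i by (auto simp: k_def)
    obtain r s where r: "\<forall>j<n. q j \<le> r j \<and> r j \<le> q j + 1"
      and s: "\<forall>j<n. q j \<le> s j \<and> s j \<le> q j + 1" and ne: "label r k \<noteq> label s k"
      using rs[rule_format, OF k(1)] by blast
    have rp: "\<forall>k<n. r k \<le> p" and sp: "\<forall>k<n. s k \<le> p"
      using q r s by (metis Suc_eq_plus1 Suc_leI order_trans)+
    have "label r k = 1 \<and> label s k = 0 \<or> label s k = 1 \<and> label r k = 0"
      using ne label01[of r k] label01[of s k] by linarith
    then show ?thesis
    proof
      assume "label r k = 1 \<and> label s k = 0"
      then show ?thesis
        using l1[OF rp _ k(1)] l0[OF sp _ k(1)] k(2) PC[OF rp] PC[OF sp] near[OF r] near[OF s]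
        by blast
    next
      assume "label s k = 1 \<and> label r k = 0"
      then show ?thesis
        using l1[OF sp _ k(1)] l0[OF rp _ k(1)] k(2) PC[OF rp] PC[OF sp] near[OF r] near[OF s]
        by blast
    qed
  qed
  have "P q \<in> C I" using PC q by (simp add: less_imp_le)
  then show ?thesis using * by blast
qed

text \<open>Let the mesh tend to 0. Near a cluster point of the centres, both witnesses for a
  coordinate tend to that point, so by continuity the two weak inequalities meet there.\<close>

theorem brouwer_unit_cube:
  fixes f :: "('i \<Rightarrow> real) \<Rightarrow> 'i \<Rightarrow> real"
  assumes "finite I" and cont: "continuous_on (PiE I (\<lambda>_. {0..1})) f"
    and f: "\<And>x. x \<in> PiE I (\<lambda>_. {0..1}) \<Longrightarrow> f x \<in> PiE I (\<lambda>_. {0..1})"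
  obtains x where "x \<in> PiE I (\<lambda>_. {0..1})" "f x = x"
proof -
  define C where "C = PiE I (\<lambda>_. {0..1::real})"
  have "\<forall>m. \<exists>c\<in>C. \<forall>i\<in>I. \<exists>a\<in>C. \<exists>b\<in>C.
           (\<forall>j\<in>I. \<bar>a j - c j\<bar> \<le> 1 / Suc m \<and> \<bar>b j - c j\<bar> \<le> 1 / Suc m) \<and> f a i \<le> a i \<and> b i \<le> f b i"
    using kuhn_sign_change[OF \<open>finite I\<close>, of f] f unfolding C_def by blast
  then obtain c where c: "\<And>m. c m \<in> C"
    and ab: "\<And>m i. i \<in> I \<Longrightarrow> \<exists>a\<in>C. \<exists>b\<in>C.
      (\<forall>j\<in>I. \<bar>a j - c m j\<bar> \<le> 1 / Suc m \<and> \<bar>b j - c m j\<bar> \<le> 1 / Suc m) \<and> f a i \<le> a i \<and> b i \<le> f b i"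
    by metis
  have "compact C" unfolding C_def by (intro compact_PiE) auto
  then obtain x where x: "x \<in> C" and cluster: "inf (nhds x) (filtermap c sequentially) \<noteq> bot"
    unfolding compact_filter using c
    by (metis (mono_tags, lifting) always_eventually eventually_filtermap
        filtermap_bot_iff sequentially_bot)
  \<comment> \<open>\<open>G\<close> plays the role of a convergent subsequence: it refines
    \<open>sequentially\<close>, and \<open>c\<close> tends to \<open>x\<close> along it. It is
    non-trivial because \<open>x\<close> is a cluster point.\<close>
  define G where "G = inf (filtercomap c (nhds x)) sequentially"
  have G: "G \<noteq> bot"
  proof
    assume "G = bot"
    then have "eventually (\<lambda>_. False) G" by simp
    then obtain Q U R where "\<And>m. U (c m) \<Longrightarrow> Q m" and U: "eventually U (nhds x)"
      and R: "eventually R sequentially" and "\<And>m. \<not> (Q m \<and> R m)"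
      unfolding G_def eventually_inf eventually_filtercomap by blast
    then have "\<forall>\<^sub>F m in sequentially. \<not> U (c m)"
      by (auto intro: eventually_mono[OF R])
    then have "eventually (\<lambda>_. False) (inf (nhds x) (filtermap c sequentially))"
      using U unfolding eventually_inf eventually_filtermap
      by (intro exI[of _ U] exI[of _ "\<lambda>y. \<not> U y"]) simp
    then show False using cluster by (simp add: trivial_limit_def)
  qed
  have cG: "(c \<longlongrightarrow> x) G"
    unfolding G_def filterlim_def by (metis filtermap_filtercomap filtermap_mono inf_le1 order_trans)
  have inv0: "((\<lambda>m. 1 / Suc m) \<longlongrightarrow> 0) G"
    using LIMSEQ_inverse_real_of_nat tendsto_mono[of G sequentially] unfolding G_def
    by (simp add: inverse_eq_divide)
  have lim: "(v \<longlongrightarrow> x) G" if v: "\<And>m. v m \<in> C" and "\<And>m j. j \<in> I \<Longrightarrow> \<bar>v m j - c m j\<bar> \<le> 1 / Suc m" for v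
    unfolding tendsto_fun_iff
  proof
    fix j
    show "((\<lambda>m. v m j) \<longlongrightarrow> x j) G"
    proof (cases "j \<in> I")
      case True
      have "((\<lambda>m. v m j - c m j) \<longlongrightarrow> 0) G"
        by (rule tendsto_0_le[OF inv0, of _ 1]) (use that(2)[OF True] in auto)
      moreover have "((\<lambda>m. c m j) \<longlongrightarrow> x j) G" using cG by (simp add: tendsto_fun_iff)
      ultimately have "((\<lambda>m. v m j - c m j + c m j) \<longlongrightarrow> 0 + x j) G" by (rule tendsto_add)
      then show ?thesis by simp
    next
      case False
      then have "v m j = x j" for m using v x by (auto simp: C_def PiE_iff extensional_def)
      then show ?thesis by simp
    qed
  qed
  have flim: "((\<lambda>m. f (v m) i) \<longlongrightarrow> f x i) G" if "(v \<longlongrightarrow> x) G" "\<And>m. v m \<in> C" for v i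
    using continuous_on_tendsto_compose[OF cont that(1)] x that(2)
    by (simp add: tendsto_fun_iff C_def)
  have "f x i = x i" for i
  proof (cases "i \<in> I")
    case True
    obtain a b where abC: "\<And>m. a m \<in> C" "\<And>m. b m \<in> C"
      and near: "\<And>m j. j \<in> I \<Longrightarrow> \<bar>a m j - c m j\<bar> \<le> 1 / Suc m"
        "\<And>m j. j \<in> I \<Longrightarrow> \<bar>b m j - c m j\<bar> \<le> 1 / Suc m"
      and le: "\<And>m. f (a m) i \<le> a m i" "\<And>m. b m i \<le> f (b m) i"
      using ab[OF True] by metis
    have a: "(a \<longlongrightarrow> x) G" and b: "(b \<longlongrightarrow> x) G"
      using lim[OF abC(1) near(1)] lim[OF abC(2) near(2)] by blast+
    have ai: "((\<lambda>m. a m i) \<longlongrightarrow> x i) G" and bi: "((\<lambda>m. b m i) \<longlongrightarrow> x i) G"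
      using a b by (auto simp: tendsto_fun_iff)
    have "f x i \<le> x i"
      by (rule tendsto_le[OF G ai flim[OF a]]) (auto simp: abC le)
    moreover have "x i \<le> f x i"
      by (rule tendsto_le[OF G flim[OF b] bi]) (auto simp: abC le)
    ultimately show ?thesis by simp
  next
    case False
    then show ?thesis using f[of x] x by (auto simp: C_def PiE_iff extensional_def)
  qed
  then show ?thesis using that[OF x[unfolded C_def]] by blast
qed

section \<open>Equilibria of convex problems\<close>

text \<open>Strong convexity of the squared distance, with exact remainder; the negative term is
  what makes minimizers unique and stable.\<close>

lemma sum_square_convex_combination:
  fixes x y z :: "'i \<Rightarrow> real"
  shows "(\<Sum>i\<in>I. (x i - (\<lambda>i\<in>I. (1 - s) * y i + s * z i) i)\<^sup>2) =
    (1 - s) * (\<Sum>i\<in>I. (x i - y i)\<^sup>2) + s * (\<Sum>i\<in>I. (x i - z i)\<^sup>2) -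
    s * (1 - s) * (\<Sum>i\<in>I. (y i - z i)\<^sup>2)"
  unfolding sum_distrib_left sum.distrib[symmetric] sum_subtractf[symmetric]
  by (intro sum.cong) (auto simp: power2_eq_square algebra_simps)

text \<open>The first argument of \<open>F\<close> ranges over the whole cube, so the minimizer map
  sends the cube into \<open>K\<close>, and its fixed points lie in \<open>K\<close>.\<close>

theorem ky_fan_equilibrium:
  fixes F :: "('i \<Rightarrow> real) \<Rightarrow> ('i \<Rightarrow> real) \<Rightarrow> real"
  defines "mix I s x y \<equiv> (\<lambda>i\<in>I. (1 - s) * x i + s * y i)"
  assumes "finite I" and K: "K \<subseteq> PiE I (\<lambda>_. {0..1})" "compact K" "K \<noteq> {}"
    and convex: "\<And>y z s. y \<in> K \<Longrightarrow> z \<in> K \<Longrightarrow> s \<in> {0..1} \<Longrightarrow> mix I s y z \<in> K"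
    and cont: "continuous_on (PiE I (\<lambda>_. {0..1}) \<times> K) (\<lambda>(x, y). F x y)"
    and convex_F: "\<And>x y z s. x \<in> PiE I (\<lambda>_. {0..1}) \<Longrightarrow> y \<in> K \<Longrightarrow> z \<in> K \<Longrightarrow> s \<in> {0..1} \<Longrightarrow>
      F x (mix I s y z) \<le> (1 - s) * F x y + s * F x z"
  obtains x where "x \<in> K" "\<And>y. y \<in> K \<Longrightarrow> F x x \<le> F x y"
proof -
  define C where "C = PiE I (\<lambda>_. {0..1::real})"
  define N where "N x y = (\<Sum>i\<in>I. (x i - y i)\<^sup>2)" for x y :: "'i \<Rightarrow> real"
  define \<Phi> where "\<Phi> x y = F x y + N x y" for x y
  have N_mix: "N x (mix I s y z) = (1 - s) * N x y + s * N x z - s * (1 - s) * N y z" for x y z s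
    unfolding N_def mix_def by (rule sum_square_convex_combination)
  have N0: "N x y \<ge> 0" "N x x = 0" for x y by (auto simp: N_def sum_nonneg)
  have \<Phi>_mix: "\<Phi> x (mix I s y z) \<le> (1 - s) * \<Phi> x y + s * \<Phi> x z - s * (1 - s) * N y z"
    if "x \<in> C" "y \<in> K" "z \<in> K" "s \<in> {0..1}" for x y z s
    using convex_F[of x y z s] that by (simp add: \<Phi>_def N_mix C_def algebra_simps)
  have cont_N: "continuous_on UNIV (\<lambda>(x, y). N x y)"
    unfolding N_def case_prod_beta
    by (intro continuous_intros continuous_on_product_then_coordinatewise[OF continuous_on_fst]
        continuous_on_product_then_coordinatewise[OF continuous_on_snd] continuous_on_id)
  have cont_\<Phi>: "continuous_on (C \<times> K) (\<lambda>(x, y). \<Phi> x y)"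
    using continuous_on_add[OF cont continuous_on_subset[OF cont_N subset_UNIV]]
    by (simp add: \<Phi>_def C_def case_prod_beta)
  have "\<exists>y\<in>K. \<forall>z\<in>K. \<Phi> x y \<le> \<Phi> x z" if "x \<in> C" for x
  proof (rule continuous_attains_inf[OF K(2,3)])
    show "continuous_on K (\<Phi> x)"
      using continuous_on_compose2[OF cont_\<Phi>, of K "\<lambda>y. (x, y)"] that
      by (auto simp: continuous_on_Pair)
  qed
  then obtain g where gK: "\<And>x. x \<in> C \<Longrightarrow> g x \<in> K"
    and g: "\<And>x y. x \<in> C \<Longrightarrow> y \<in> K \<Longrightarrow> \<Phi> x (g x) \<le> \<Phi> x y"
    by metis
  \<comment> \<open>compare \<open>g x\<close> with the midpoint of \<open>g x\<close> and \<open>y\<close>\<close>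
  have strong: "N (g x) y / 2 \<le> \<Phi> x y - \<Phi> x (g x)" if "x \<in> C" "y \<in> K" for x y
    using \<Phi>_mix[OF that(1) gK[OF that(1)] that(2), of "1/2"]
      g[OF that(1) convex[OF gK[OF that(1)] that(2), of "1/2"]] by simp
  have "continuous_on C (\<lambda>x. g x i)" for i
  proof (cases "i \<in> I")
    case True
    show ?thesis
      unfolding continuous_on_def
    proof (intro ballI tendstoI)
      fix x and e :: real
      assume x: "x \<in> C" and "e > 0"
      obtain X where X: "x \<in> X" "open X"
        "\<forall>x'\<in>X \<inter> C. \<forall>y\<in>K. dist (\<Phi> x' y) (\<Phi> x y) \<le> e\<^sup>2 / 4"
        using continuous_on_prod_compactE[OF cont_\<Phi> K(2) x, of "e\<^sup>2 / 4"] \<open>e > 0\<close> by auto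
      \<comment> \<open>Add \<open>strong\<close> at \<open>x\<close> and at \<open>x'\<close>, each
        tested with the minimizer of the other: \<open>N (g x') (g x)\<close> is at most the sum of
        two changes of \<open>\<Phi>\<close> with the second argument fixed, and these are small
        uniformly over the compact \<open>K\<close>.\<close>
      have "dist (g x' i) (g x i) < e" if x': "x' \<in> X \<inter> C" for x'
      proof -
        have "(g x' i - g x i)\<^sup>2 \<le> N (g x') (g x)"
          unfolding N_def using \<open>finite I\<close> True by (intro member_le_sum) auto
        moreover have "N (g x) (g x') = N (g x') (g x)"
          by (simp add: N_def power2_commute)
        moreover have "\<bar>\<Phi> x' (g x) - \<Phi> x (g x)\<bar> \<le> e\<^sup>2 / 4" "\<bar>\<Phi> x' (g x') - \<Phi> x (g x')\<bar> \<le> e\<^sup>2 / 4"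
          using X(3) x' gK x by (auto simp: dist_real_def)
        ultimately have "(g x' i - g x i)\<^sup>2 \<le> e\<^sup>2 / 2"
          using strong[OF x gK[of x']] strong[OF IntD2[OF x'] gK[OF x]] IntD2[OF x'] by linarith
        also have "\<dots> < e\<^sup>2" using \<open>e > 0\<close> by simp
        finally show ?thesis
          using \<open>e > 0\<close> power2_less_imp_less[of "\<bar>g x' i - g x i\<bar>" e] by (simp add: dist_real_def)
      qed
      then show "\<forall>\<^sub>F x' in at x within C. dist (g x' i) (g x i) < e"
        unfolding eventually_at_topological using X by blast
    qed
  next
    case False
    then have "g x i = undefined" if "x \<in> C" for x
      using gK[OF that] K(1) by (auto simp: PiE_iff extensional_def)
    then show ?thesis by (simp cong: continuous_on_cong)
  qed
  then have "continuous_on C g" by (rule continuous_on_coordinatewise_then_product)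
  moreover have "g x \<in> C" if "x \<in> C" for x
    unfolding C_def by (rule subsetD[OF K(1) gK[OF that]])
  ultimately obtain x where x: "x \<in> C" "g x = x"
    unfolding C_def by (rule brouwer_unit_cube[OF \<open>finite I\<close>])
  then have xK: "x \<in> K" using gK by force
  moreover have "F x x \<le> F x y" if "y \<in> K" for y
  proof (rule ccontr)
    assume "\<not> F x x \<le> F x y"
    define d where "d = F x x - F x y"
    have d: "d > 0" using \<open>\<not> F x x \<le> F x y\<close> by (simp add: d_def)
    \<comment> \<open>With this step the linear gain \<open>s * d\<close> exceeds the quadratic cost
      \<open>s * (s * N x y)\<close>, and \<open>s\<close> stays in the unit interval even if
      \<open>N x y = 0\<close>.\<close>
    define s where "s = d / (d + N x y)"
    have s: "s > 0" "s \<le> 1" using d N0(1)[of x y] by (auto simp: s_def divide_simps)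
    have "\<Phi> x x \<le> \<Phi> x (mix I s x y)"
      using g[OF x(1) convex[OF xK that, of s]] x(2) s by simp
    also have "\<dots> \<le> (1 - s) * \<Phi> x x + s * \<Phi> x y - s * (1 - s) * N x y"
      using \<Phi>_mix[OF x(1) xK that, of s] s by simp
    finally have "s * d \<le> s * (s * N x y)"
      by (simp add: \<Phi>_def N0 d_def algebra_simps)
    then have "d * (d + N x y) \<le> d * N x y"
      using s(1) d N0(1)[of x y] by (simp add: s_def divide_simps)
    then show False using mult_pos_pos[OF d d] by (simp add: algebra_simps)
  qed
  ultimately show ?thesis using that by blast
qed

section \<open>Worst-case means\<close>

text \<open>The support function of \<open>Q\<close>, read on the coordinates in
  \<open>A\<close>.\<close>

definition worst_mean :: "'w set \<Rightarrow> ('w \<Rightarrow> real) set \<Rightarrow> ('w \<Rightarrow> real) \<Rightarrow> real" where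
  "worst_mean A Q L = (SUP q\<in>Q. \<Sum>t\<in>A. q t * L t)"

definition prob_weights :: "'w set \<Rightarrow> ('w \<Rightarrow> real) set" where
  "prob_weights A = {q. (\<forall>t\<in>A. 0 \<le> q t) \<and> sum q A = 1}"

text \<open>The real-valued \<open>SUP\<close> is meaningful only for bounded families; here every
  weight is at most 1.\<close>

lemma bdd_above_means:
  assumes "finite A" "Q \<subseteq> prob_weights A"
  shows "bdd_above ((\<lambda>q. \<Sum>t\<in>A. q t * L t) ` Q)"
proof (rule bdd_aboveI2)
  fix q assume "q \<in> Q"
  then have q: "\<And>t. t \<in> A \<Longrightarrow> 0 \<le> q t" "sum q A = 1" using assms(2) by (auto simp: prob_weights_def)
  have "q t * L t \<le> \<bar>L t\<bar>" if "t \<in> A" for t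
  proof -
    have "q t \<le> 1" using member_le_sum[of t A q] q assms(1) that by auto
    then show ?thesis
      using q(1)[OF that] mult_left_le_one_le[of "\<bar>L t\<bar>" "q t"]
        mult_left_mono[of "L t" "\<bar>L t\<bar>" "q t"] by linarith
  qed
  then show "(\<Sum>t\<in>A. q t * L t) \<le> (\<Sum>t\<in>A. \<bar>L t\<bar>)" by (rule sum_mono)
qed

lemma worst_mean_cong: "(\<And>t. t \<in> A \<Longrightarrow> L t = L' t) \<Longrightarrow> worst_mean A Q L = worst_mean A Q L'"
  unfolding worst_mean_def by (intro SUP_cong sum.cong) auto

lemma worst_mean_le_add:
  assumes "finite A" "Q \<subseteq> prob_weights A" "Q \<noteq> {}"
    and le: "\<And>t. t \<in> A \<Longrightarrow> L t \<le> L' t + e"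
  shows "worst_mean A Q L \<le> worst_mean A Q L' + e"
  unfolding worst_mean_def
proof (rule cSUP_least[OF assms(3)])
  fix q assume q: "q \<in> Q"
  then have w: "\<And>t. t \<in> A \<Longrightarrow> 0 \<le> q t" "sum q A = 1" using assms(2) by (auto simp: prob_weights_def)
  have "(\<Sum>t\<in>A. q t * L t) \<le> (\<Sum>t\<in>A. q t * (L' t + e))"
    by (intro sum_mono mult_left_mono le w)
  also have "\<dots> = (\<Sum>t\<in>A. q t * L' t) + e"
    using w(2) by (simp add: distrib_left sum.distrib flip: sum_distrib_right)
  also have "\<dots> \<le> (SUP q\<in>Q. \<Sum>t\<in>A. q t * L' t) + e"
    by (intro add_right_mono cSUP_upper q bdd_above_means assms)
  finally show "(\<Sum>t\<in>A. q t * L t) \<le> (SUP q\<in>Q. \<Sum>t\<in>A. q t * L' t) + e" .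
qed

text \<open>Each mean is 1-Lipschitz in the maximum distance, which the sum dominates, and a
  supremum inherits the bound. Continuity follows from this.\<close>

lemma worst_mean_diff_le:
  assumes "finite A" "Q \<subseteq> prob_weights A" "Q \<noteq> {}"
  shows "\<bar>worst_mean A Q L - worst_mean A Q L'\<bar> \<le> (\<Sum>t\<in>A. \<bar>L t - L' t\<bar>)"
proof -
  define e where "e = (\<Sum>t\<in>A. \<bar>L t - L' t\<bar>)"
  have *: "\<bar>L t - L' t\<bar> \<le> e" if "t \<in> A" for t
    unfolding e_def by (rule member_le_sum[OF that]) (use assms(1) in auto)
  have "worst_mean A Q L \<le> worst_mean A Q L' + e"
    by (rule worst_mean_le_add[OF assms]) (drule *, linarith)
  moreover have "worst_mean A Q L' \<le> worst_mean A Q L + e"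
    by (rule worst_mean_le_add[OF assms]) (drule *, linarith)
  ultimately show ?thesis unfolding e_def[symmetric] by linarith
qed

text \<open>Each mean is linear in the loss, and a supremum of linear functions is convex.\<close>

lemma worst_mean_convex:
  assumes "finite A" "Q \<subseteq> prob_weights A" "Q \<noteq> {}" and s: "s \<in> {0..1}"
  shows "worst_mean A Q (\<lambda>t. (1 - s) * L t + s * L' t) \<le>
    (1 - s) * worst_mean A Q L + s * worst_mean A Q L'"
  unfolding worst_mean_def
proof (rule cSUP_least[OF assms(3)])
  fix q assume q: "q \<in> Q"
  have "(\<Sum>t\<in>A. q t * ((1 - s) * L t + s * L' t)) =
      (1 - s) * (\<Sum>t\<in>A. q t * L t) + s * (\<Sum>t\<in>A. q t * L' t)"
    by (simp add: sum_distrib_left algebra_simps sum.distrib sum_subtractf)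
  also have "\<dots> \<le> (1 - s) * (SUP q\<in>Q. \<Sum>t\<in>A. q t * L t) + s * (SUP q\<in>Q. \<Sum>t\<in>A. q t * L' t)"
    using s by (intro add_mono mult_left_mono cSUP_upper q bdd_above_means assms) auto
  finally show "(\<Sum>t\<in>A. q t * ((1 - s) * L t + s * L' t)) \<le> \<dots>" .
qed

lemma continuous_on_worst_mean:
  assumes A: "finite A" "Q \<subseteq> prob_weights A" "Q \<noteq> {}"
    and cont: "\<And>t. t \<in> A \<Longrightarrow> continuous_on S (\<lambda>c. L c t)"
  shows "continuous_on S (\<lambda>c. worst_mean A Q (L c))"
  unfolding continuous_on_def
proof
  fix x assume x: "x \<in> S"
  have "((\<lambda>c. \<bar>L c t - L x t\<bar>) \<longlongrightarrow> 0) (at x within S)" if "t \<in> A" for t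
    using cont[OF that] x by (intro tendsto_rabs_zero LIM_zero) (simp add: continuous_on_def)
  then have "((\<lambda>c. \<Sum>t\<in>A. \<bar>L c t - L x t\<bar>) \<longlongrightarrow> 0) (at x within S)"
    by (rule tendsto_null_sum)
  then have "((\<lambda>c. worst_mean A Q (L c) - worst_mean A Q (L x)) \<longlongrightarrow> 0) (at x within S)"
    by (rule Lim_null_comparison[rotated])
      (simp only: real_norm_def worst_mean_diff_le[OF A] eventually_True)
  then show "((\<lambda>c. worst_mean A Q (L c)) \<longlongrightarrow> worst_mean A Q (L x)) (at x within S)"
    by (rule LIM_zero_cancel)
qed

section \<open>Conditional risk on a finite probability space\<close>

text \<open>\<open>\<tau>\<close> is the observed signal, in a game the own type. \<open>S\<close>
  may contain values that are never attained, so facts about non-empty cells are stated for cells of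
  the form \<open>cell (\<tau> x)\<close>.\<close>

locale finite_information = prob_space M for M :: "'w measure" +
  fixes \<tau> :: "'w \<Rightarrow> 's" and S :: "'s set"
  assumes finite_space: "finite (space M)"
    and sets_M: "sets M = Pow (space M)"
    and full_support: "\<And>x. x \<in> space M \<Longrightarrow> measure M {x} > 0"
    and \<tau>: "\<And>x. x \<in> space M \<Longrightarrow> \<tau> x \<in> S"
begin

definition cell :: "'s \<Rightarrow> 'w set" where
  "cell s = {x \<in> space M. \<tau> x = s}"

definition info :: "'w measure" where
  "info = sigma (space M) {cell s | s. s \<in> S}"

text \<open>The conditional probabilities given the cell, reweighted by the density
  \<open>Z'\<close>.\<close>

definition cell_weights :: "(('w \<Rightarrow> real) \<Rightarrow> real) \<Rightarrow> ('w \<Rightarrow> real) \<Rightarrow> 's \<Rightarrow> ('w \<Rightarrow> real) set" where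
  "cell_weights \<rho> Z s = (\<lambda>Z' x. measure M {x} * Z' x / measure M (cell s)) ` dual_set M info \<rho> Z"

lemma measurable_M: "f \<in> borel_measurable M"
  by (auto simp: measurable_def sets_M)

lemma finite_cell: "finite (cell s)"
  using finite_space by (simp add: cell_def)

text \<open>A point where \<open>P\<close> fails would be a null singleton, contrary to full
  support.\<close>

lemma AE_M_iff: "(AE x in M. P x) \<longleftrightarrow> (\<forall>x\<in>space M. P x)"
proof
  assume AE: "AE x in M. P x"
  show "\<forall>x\<in>space M. P x"
  proof (rule ballI, rule ccontr)
    fix x assume x: "x \<in> space M" "\<not> P x"
    have "AE y in M. y \<notin> {x}"
      using AE by eventually_elim (use x in auto)
    then have "measure M {x} = 0"
      using x(1) by (subst (asm) AE_iff_measurable[of "{x}"]) (auto simp: sets_M measure_def)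
    with full_support[OF x(1)] show False by simp
  qed
qed auto

lemma integrable_M: "integrable M (f :: 'w \<Rightarrow> real)"
proof (rule integrable_const_bound)
  show "AE x in M. norm (f x) \<le> (\<Sum>x\<in>space M. \<bar>f x\<bar>)"
    using finite_space by (auto simp: AE_M_iff intro!: member_le_sum[of _ _ "\<lambda>x. \<bar>f x\<bar>"])
qed (rule measurable_M)

lemma set_integral_M:
  fixes f :: "'w \<Rightarrow> real"
  assumes "A \<subseteq> space M"
  shows "(\<integral>x\<in>A. f x \<partial>M) = (\<Sum>x\<in>A. measure M {x} * f x)"
proof -
  have A: "finite A" using assms finite_space by (rule finite_subset)
  have "(\<integral>x\<in>A. f x \<partial>M) = (\<integral>x. (\<Sum>y\<in>A. f y * indicator {y} x) \<partial>M)"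
    unfolding set_lebesgue_integral_def
    by (intro Bochner_Integration.integral_cong)
      (auto simp: A indicator_def if_distrib sum.delta sum.delta' cong: if_cong)
  also have "\<dots> = (\<Sum>y\<in>A. \<integral>x. f y * indicator {y} x \<partial>M)"
    by (intro Bochner_Integration.integral_sum integrable_M)
  also have "\<dots> = (\<Sum>y\<in>A. measure M {y} * f y)"
    using assms by (intro sum.cong) (auto simp: Int_absorb2)
  finally show ?thesis .
qed

lemma space_info: "space info = space M" and
  sets_info: "sets info = sigma_sets (space M) {cell s | s. s \<in> S}"
  unfolding info_def by (auto simp: cell_def intro!: space_measure_of sets_measure_of)

lemma cell_in_info: "s \<in> S \<Longrightarrow> cell s \<in> sets info"
  unfolding sets_info by blast

lemma sigma_finite_subalgebra_info: "sigma_finite_subalgebra M info"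
proof (intro finite_measure_subalgebra_is_sigma_finite finite_measure_subalgebra.intro
    finite_measure_subalgebra_axioms.intro finite_measure_axioms)
  show "subalgebra M info"
    using sets.sets_into_space[of _ info] by (auto simp: subalgebra_def space_info sets_M)
qed

text \<open>No set in the generated algebra separates points of one cell; apply this to a level set
  of \<open>f\<close>.\<close>

lemma measurable_info_const:
  fixes f :: "'w \<Rightarrow> real"
  assumes f: "f \<in> borel_measurable info" and xy: "x \<in> space M" "y \<in> space M" "\<tau> x = \<tau> y"
  shows "f x = f y"
proof -
  have sat: "x \<in> A \<longleftrightarrow> y \<in> A" if "A \<in> sets info" for A
    using that unfolding sets_info by induction (use xy in \<open>auto simp: cell_def\<close>)
  have "{z \<in> space info. f z = f x} \<in> sets info" using f by measurable
  from sat[OF this] show ?thesis using xy by (simp add: space_info)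
qed

lemma measurable_info_comp: "(\<lambda>x. h (\<tau> x)) \<in> borel_measurable info" for h :: "'s \<Rightarrow> real"
proof (rule measurableI)
  fix B :: "real set" assume "B \<in> sets borel"
  have "(\<lambda>x. h (\<tau> x)) -` B \<inter> space info = (\<Union>s\<in>{s \<in> \<tau> ` space M. h s \<in> B}. cell s)"
    by (auto simp: space_info cell_def)
  also have "\<dots> \<in> sets info"
    using finite_space \<tau> by (intro sets.finite_UN cell_in_info) auto
  finally show "(\<lambda>x. h (\<tau> x)) -` B \<inter> space info \<in> sets info" .
qed simp

lemma measure_cell: "measure M (cell s) = (\<Sum>x\<in>cell s. measure M {x})"
  using finite_cell by (intro finite_measure_eq_sum_singleton) (auto simp: sets_M cell_def)

lemma measure_cell_pos: "x \<in> space M \<Longrightarrow> measure M (cell (\<tau> x)) > 0"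
  unfolding measure_cell using finite_cell full_support by (intro sum_pos) (auto simp: cell_def)

text \<open>The conditional expectation is constant on the cell, and its integral over the cell is
  that of \<open>f\<close>. With positive cell measure this fixes its value at every point, not just
  almost surely.\<close>

lemma real_cond_exp_info:
  assumes x: "x \<in> space M"
  shows "real_cond_exp M info f x = (\<Sum>y\<in>cell (\<tau> x). measure M {y} * f y) / measure M (cell (\<tau> x))"
proof -
  let ?C = "cell (\<tau> x)"
  have "(\<Sum>y\<in>?C. measure M {y} * f y) = (\<integral>y\<in>?C. f y \<partial>M)"
    by (intro set_integral_M[symmetric]) (auto simp: cell_def)
  also have "\<dots> = (\<integral>y\<in>?C. real_cond_exp M info f y \<partial>M)"
    using \<tau>[OF x] by (intro sigma_finite_subalgebra.real_cond_exp_intA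
        sigma_finite_subalgebra_info integrable_M cell_in_info)
  also have "\<dots> = (\<Sum>y\<in>?C. measure M {y} * real_cond_exp M info f y)"
    by (intro set_integral_M) (auto simp: cell_def)
  also have "\<dots> = (\<Sum>y\<in>?C. measure M {y} * real_cond_exp M info f x)"
    by (intro sum.cong refl arg_cong2[of _ _ _ _ "(*)"] measurable_info_const)
      (use x in \<open>auto simp: cell_def\<close>)
  also have "\<dots> = measure M ?C * real_cond_exp M info f x"
    by (simp add: measure_cell sum_distrib_right)
  finally show ?thesis using measure_cell_pos[OF x] by simp
qed

text \<open>For the constant 1 the dual inequality is the one in the admissibility of
  \<open>Z\<close>.\<close>

lemma one_in_dual_set:
  assumes "admissible_dual M info \<rho> Z"
  shows "(\<lambda>_. 1) \<in> dual_set M info \<rho> Z"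
proof -
  have "real_cond_exp M info (\<lambda>_. 1) x = 1" if "x \<in> space M" for x
    unfolding real_cond_exp_info[OF that] using measure_cell_pos[OF that]
    by (simp add: measure_cell)
  then show ?thesis
    using assms by (auto simp: dual_set_def admissible_dual_def AE_M_iff)
qed

lemma cell_weights_nonempty:
  "admissible_dual M info \<rho> Z \<Longrightarrow> cell_weights \<rho> Z s \<noteq> {}"
  using one_in_dual_set unfolding cell_weights_def by blast

text \<open>The normalization of the conditional expectation of \<open>Z'\<close> says exactly that
  the weights on the cell sum to 1.\<close>

lemma cell_weights_subset:
  assumes "x \<in> space M"
  shows "cell_weights \<rho> Z (\<tau> x) \<subseteq> prob_weights (cell (\<tau> x))"
  unfolding cell_weights_def
proof (rule image_subsetI)
  fix Z' assume "Z' \<in> dual_set M info \<rho> Z"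
  then have "\<And>y. y \<in> space M \<Longrightarrow> 0 \<le> Z' y" "real_cond_exp M info Z' x = 1"
    using assms by (auto simp: dual_set_def AE_M_iff)
  then show "(\<lambda>y. measure M {y} * Z' y / measure M (cell (\<tau> x))) \<in> prob_weights (cell (\<tau> x))"
    unfolding prob_weights_def real_cond_exp_info[OF assms]
    by (auto simp: cell_def sum_divide_distrib)
qed

text \<open>Under full support an essential supremum is the pointwise supremum, which can be
  computed cell by cell.\<close>

lemma ext_cond_risk_eq:
  assumes Z: "admissible_dual M info \<rho> Z" and x: "x \<in> space M"
  shows "ext_cond_risk M info \<rho> Z L x = worst_mean (cell (\<tau> x)) (cell_weights \<rho> Z (\<tau> x)) L"
proof -
  define D where "D = dual_set M info \<rho> Z"
  define \<X> where "\<X> = {real_cond_exp M info (\<lambda>x. L x * Z' x) | Z'. Z' \<in> D}"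
  define Y0 where "Y0 x = worst_mean (cell (\<tau> x)) (cell_weights \<rho> Z (\<tau> x)) L" for x
  have val: "real_cond_exp M info (\<lambda>x. L x * Z' x) x =
      (\<Sum>y\<in>cell (\<tau> x). measure M {y} * Z' y / measure M (cell (\<tau> x)) * L y)"
    if "x \<in> space M" for x Z'
    unfolding real_cond_exp_info[OF that] sum_divide_distrib by (intro sum.cong) auto
  have upper: "X x \<le> Y0 x" if "X \<in> \<X>" "x \<in> space M" for X x
  proof -
    from that(1) obtain Z' where Z': "Z' \<in> D" "X = real_cond_exp M info (\<lambda>x. L x * Z' x)"
      by (auto simp: \<X>_def)
    then have "(\<lambda>y. measure M {y} * Z' y / measure M (cell (\<tau> x))) \<in> cell_weights \<rho> Z (\<tau> x)"
      by (auto simp: cell_weights_def D_def)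
    then show ?thesis
      unfolding Z'(2) val[OF that(2)] Y0_def worst_mean_def
      by (rule cSUP_upper[OF _ bdd_above_means[OF finite_cell cell_weights_subset[OF that(2)]]])
  qed
  have least: "Y0 x \<le> w" if "\<And>X. X \<in> \<X> \<Longrightarrow> X x \<le> w" "x \<in> space M" for x w
    unfolding Y0_def worst_mean_def
  proof (rule cSUP_least[OF cell_weights_nonempty[OF Z]])
    fix q assume "q \<in> cell_weights \<rho> Z (\<tau> x)"
    then obtain Z' where "Z' \<in> D" "q = (\<lambda>y. measure M {y} * Z' y / measure M (cell (\<tau> x)))"
      by (auto simp: cell_weights_def D_def)
    then show "(\<Sum>y\<in>cell (\<tau> x). q y * L y) \<le> w"
      using that(1)[of "real_cond_exp M info (\<lambda>x. L x * Z' x)"] unfolding val[OF that(2)] \<X>_def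
      by blast
  qed
  define P where "P Y \<longleftrightarrow> Y \<in> borel_measurable info \<and> is_ess_sup M \<X> Y" for Y
  have ess_sup: "is_ess_sup M \<X> Y \<longleftrightarrow> (\<forall>X\<in>\<X>. \<forall>x\<in>space M. X x \<le> Y x) \<and>
      (\<forall>W. (\<forall>X\<in>\<X>. \<forall>x\<in>space M. X x \<le> W x) \<longrightarrow> (\<forall>x\<in>space M. Y x \<le> W x))" for Y
    by (simp only: is_ess_sup_def AE_M_iff measurable_M Ball_def simp_thms)
  have "Y0 \<in> borel_measurable info"
    unfolding Y0_def by (rule measurable_info_comp)
  \<comment> \<open>\<open>Y0\<close> is an eligible version, so the \<open>SOME\<close> in
    \<open>ext_cond_risk\<close> returns an essential supremum rather than an arbitrary
    function.\<close>
  then have "P Y0"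
    unfolding P_def ess_sup using upper least by blast
  then have "P (SOME Y. P Y)" by (rule someI[of P])
  moreover have "ext_cond_risk M info \<rho> Z L = (SOME Y. P Y)"
    unfolding ext_cond_risk_def P_def D_def \<X>_def by (rule refl)
  ultimately have "is_ess_sup M \<X> (ext_cond_risk M info \<rho> Z L)"
    by (simp only: P_def)
  then have Y: "\<And>X. X \<in> \<X> \<Longrightarrow> X x \<le> ext_cond_risk M info \<rho> Z L x"
      "ext_cond_risk M info \<rho> Z L x \<le> Y0 x"
    using x upper unfolding ess_sup by blast+
  have "Y0 x \<le> ext_cond_risk M info \<rho> Z L x"
    using least[OF _ x] Y(1) by blast
  with Y(2) show ?thesis by (simp add: Y0_def)
qed

end

section \<open>Interim risk in a game\<close>

lemma finite_type_profiles: "risk_averse_game G \<Longrightarrow> finite (type_profiles G)"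
  unfolding type_profiles_def by (intro finite_PiE) (simp_all add: risk_averse_game_def players_def)

text \<open>One weight set \<open>q\<close> serves all losses \<open>L\<close>, so risks of
  different profiles become comparable.\<close>

lemma interim_risk_worst_mean:
  assumes G: "risk_averse_game G" and i: "i \<in> players G"
    and Z: "admissible_dual (prior G) (interim_info G i) (risk_pref G i) Z"
    and s: "s \<in> types G i"
  obtains q where "q \<noteq> {}" "q \<subseteq> prob_weights {t \<in> type_profiles G. t i = s}"
    "\<And>L. interim_risk G i Z L s = worst_mean {t \<in> type_profiles G. t i = s} q L"
proof -
  have sp: "space (prior G) = type_profiles G" using G by (simp add: risk_averse_game_def)
  have fi: "finite_information (prior G) (\<lambda>t. t i) (types G i)"
    using G i finite_type_profiles[OF G]
    by (auto simp: finite_information_def finite_information_axioms_def risk_averse_game_def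
        type_profiles_def)
  define cell where "cell = finite_information.cell (prior G) (\<lambda>t. t i)"
  define info where "info = finite_information.info (prior G) (\<lambda>t. t i) (types G i)"
  define Q where
    "Q = finite_information.cell_weights (prior G) (\<lambda>t. t i) (types G i) (risk_pref G i) Z"
  have cell: "cell s = {t \<in> type_profiles G. t i = s}" for s
    by (simp add: cell_def finite_information.cell_def[OF fi] sp)
  have info: "info = interim_info G i"
    using cell
    by (simp add: info_def cell_def finite_information.info_def[OF fi] interim_info_def sp)
  \<comment> \<open>The cell must be inhabited: otherwise the value described by \<open>THE\<close>
    in \<open>interim_risk\<close> would not be unique.\<close>
  obtain t where t: "t \<in> type_profiles G" "t i = s"
  proof -
    have "PiE (players G) (\<lambda>j. if j = i then {s} else types G j) \<noteq> {}"
      using G by (auto simp: PiE_eq_empty_iff risk_averse_game_def)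
    then obtain t where t: "t \<in> PiE (players G) (\<lambda>j. if j = i then {s} else types G j)" by blast
    have "t i = s" using PiE_mem[OF t i] by simp
    moreover have "t \<in> type_profiles G"
      unfolding type_profiles_def by (rule subsetD[OF PiE_mono t]) (use s in auto)
    ultimately show ?thesis using that by blast
  qed
  show ?thesis
  proof (rule that[of "Q s"])
    show "Q s \<noteq> {}"
      using finite_information.cell_weights_nonempty[OF fi] Z
      by (simp add: Q_def flip: info info_def)
    show "Q s \<subseteq> prob_weights {t \<in> type_profiles G. t i = s}"
      using finite_information.cell_weights_subset[OF fi, of t "risk_pref G i" Z] t
      by (simp add: Q_def sp cell flip: cell_def)
    fix L
    have ext: "ext_cond_risk (prior G) (interim_info G i) (risk_pref G i) Z L u =
        worst_mean {t \<in> type_profiles G. t i = s} (Q s) L" if "u \<in> type_profiles G" "u i = s" for u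
      using finite_information.ext_cond_risk_eq[OF fi, of "risk_pref G i" Z u L] that Z
      by (simp add: Q_def sp info cell flip: cell_def info_def)
    show "interim_risk G i Z L s = worst_mean {t \<in> type_profiles G. t i = s} (Q s) L"
      unfolding interim_risk_def using ext ext[OF t] t by (intro the_equality) (blast, metis)
  qed
qed

section \<open>Existence of equilibria\<close>

definition mixed_index :: "('t, 'a) game \<Rightarrow> (nat \<times> 't \<times> 'a) set" where
  "mixed_index G = (SIGMA i:players G. types G i \<times> actions G i)"

definition mixed_profiles :: "('t, 'a) game \<Rightarrow> (nat \<times> 't \<times> 'a \<Rightarrow> real) set" where
  "mixed_profiles G = {x \<in> PiE (mixed_index G) (\<lambda>_. {0..1}).
     \<forall>i\<in>players G. \<forall>s\<in>types G i. (\<Sum>a\<in>actions G i. x (i, s, a)) = 1}"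

text \<open>Extension by 0 keeps the \<open>undefined\<close> coordinates of \<open>x\<close> out of
  \<open>embed_pmf\<close>.\<close>

definition profile_of :: "('t, 'a) game \<Rightarrow> (nat \<times> 't \<times> 'a \<Rightarrow> real) \<Rightarrow> ('t, 'a) profile" where
  "profile_of G x = (\<lambda>i\<in>players G. \<lambda>s\<in>types G i.
     embed_pmf (\<lambda>a. if a \<in> actions G i then x (i, s, a) else 0))"

text \<open>Player \<open>i\<close> follows \<open>y\<close> and the others follow \<open>x\<close>; \<open>x\<close> ranges over the whole cube, where the
  formula still makes sense, so that Brouwer's theorem needs no projection onto the strategies.\<close>

definition deviation_loss ::
    "('t, 'a) game \<Rightarrow> nat \<Rightarrow> (nat \<times> 't \<times> 'a \<Rightarrow> real) \<Rightarrow> (nat \<times> 't \<times> 'a \<Rightarrow> real) \<Rightarrow> (nat \<Rightarrow> 't) \<Rightarrow> real"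
  where
  "deviation_loss G i x y t = (\<Sum>a\<in>action_profiles G.
     loss G i t a * (y (i, t i, a i) * (\<Prod>j\<in>players G - {i}. x (j, t j, a j))))"

lemma finite_mixed_index: "risk_averse_game G \<Longrightarrow> finite (mixed_index G)"
  unfolding mixed_index_def
  by (intro finite_SigmaI finite_cartesian_product) (simp_all add: risk_averse_game_def players_def)

text \<open>The normalization equations cut a closed set out of a compact cube.\<close>

lemma compact_mixed_profiles: "compact (mixed_profiles G)"
proof -
  define T where "T = (SIGMA i:players G. types G i)"
  have eq: "mixed_profiles G = PiE (mixed_index G) (\<lambda>_. {0..1}) \<inter>
      (\<Inter>(i, s)\<in>T. {x. (\<Sum>a\<in>actions G i. x (i, s, a)) = 1})"
    by (auto simp: mixed_profiles_def T_def)
  have "closed {x. (\<Sum>a\<in>actions G i. x (i, s, a)) = (1::real)}" for i s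
    by (intro closed_Collect_eq continuous_on_sum continuous_on_product_coordinates continuous_on_const)
  then show ?thesis
    unfolding eq by (intro compact_Int_closed compact_PiE closed_INT) auto
qed

lemma mixed_profiles_nonempty:
  assumes G: "risk_averse_game G"
  shows "mixed_profiles G \<noteq> {}"
proof -
  define x where "x = (\<lambda>(i, s, a)\<in>mixed_index G. if a = (SOME a. a \<in> actions G i) then 1 else 0::real)"
  have "(\<Sum>a\<in>actions G i. x (i, s, a)) = 1" if "i \<in> players G" "s \<in> types G i" for i s
  proof -
    have "finite (actions G i)" "(SOME a. a \<in> actions G i) \<in> actions G i"
      using G that by (auto simp: risk_averse_game_def some_in_eq)
    then show ?thesis using that by (simp add: x_def mixed_index_def)
  qed
  then have "x \<in> mixed_profiles G"
    by (auto simp: mixed_profiles_def x_def)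
  then show ?thesis by blast
qed

lemma mixed_profiles_convex:
  assumes x: "x \<in> mixed_profiles G" and y: "y \<in> mixed_profiles G" and r: "r \<in> {0..1}"
  shows "(\<lambda>k\<in>mixed_index G. (1 - r) * x k + r * y k) \<in> mixed_profiles G"
proof -
  have "(1 - r) * x k + r * y k \<in> {0..1}" if "k \<in> mixed_index G" for k
  proof -
    have "x \<in> PiE (mixed_index G) (\<lambda>_. {0..1})" "y \<in> PiE (mixed_index G) (\<lambda>_. {0..1})"
      using x y by (simp_all add: mixed_profiles_def)
    from this[THEN PiE_mem, OF that] have "x k \<in> {0..1}" "y k \<in> {0..1}" .
    then show ?thesis using r convex_bound_le[of "x k" 1 "y k" "1 - r" r] by simp
  qed
  moreover have "(\<Sum>a\<in>actions G i. (\<lambda>k\<in>mixed_index G. (1 - r) * x k + r * y k) (i, s, a)) = 1"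
    if "i \<in> players G" "s \<in> types G i" for i s
  proof -
    have "(\<Sum>a\<in>actions G i. (\<lambda>k\<in>mixed_index G. (1 - r) * x k + r * y k) (i, s, a)) =
        (1 - r) * (\<Sum>a\<in>actions G i. x (i, s, a)) + r * (\<Sum>a\<in>actions G i. y (i, s, a))"
      unfolding sum_distrib_left sum.distrib[symmetric]
      using that by (intro sum.cong) (auto simp: mixed_index_def)
    then show ?thesis using x y that by (simp add: mixed_profiles_def)
  qed
  ultimately show ?thesis by (auto simp: mixed_profiles_def)
qed

lemma pmf_profile_of:
  assumes G: "risk_averse_game G" and x: "x \<in> mixed_profiles G"
    and i: "i \<in> players G" and s: "s \<in> types G i"
  shows "pmf (profile_of G x i s) a = (if a \<in> actions G i then x (i, s, a) else 0)"
proof -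
  let ?f = "\<lambda>a. if a \<in> actions G i then x (i, s, a) else 0"
  have nonneg: "0 \<le> ?f a" for a
    using x i s by (auto simp: mixed_profiles_def mixed_index_def PiE_iff)
  have fin: "finite (actions G i)" using G i by (simp add: risk_averse_game_def)
  have "(\<integral>\<^sup>+ a. ennreal (?f a) \<partial>count_space UNIV) = (\<Sum>a\<in>actions G i. ennreal (?f a))"
    by (rule nn_integral_count_space'[OF fin]) auto
  also have "\<dots> = ennreal (\<Sum>a\<in>actions G i. ?f a)"
    using nonneg by (intro sum_ennreal)
  also have "(\<Sum>a\<in>actions G i. ?f a) = 1"
    using x i s by (simp add: mixed_profiles_def)
  finally have "pmf (embed_pmf ?f) a = ?f a"
    using nonneg by (intro pmf_embed_pmf) simp_all
  then show ?thesis using i s by (simp add: profile_of_def)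
qed

lemma profile_of_in_strategy_profiles:
  assumes G: "risk_averse_game G" and x: "x \<in> mixed_profiles G"
  shows "profile_of G x \<in> strategy_profiles G"
proof -
  have "set_pmf (profile_of G x i s) \<subseteq> actions G i" if "i \<in> players G" "s \<in> types G i" for i s
    using pmf_profile_of[OF assms that] by (auto simp: set_pmf_eq split: if_splits)
  then show ?thesis
    by (auto simp: strategy_profiles_def strategies_def profile_of_def PiE_iff)
qed

section \<open>Losses as polynomials in the strategy coordinates\<close>

lemma players_finite: "finite (players G)"
  by (simp add: players_def)

text \<open>Split off the factor of player \<open>i\<close>. Separate \<open>x\<close> and
  \<open>y\<close> cover both a profile and a deviation from it.\<close>

lemma random_loss_eq_deviation_loss:
  assumes i: "i \<in> players G"
    and own: "\<And>a. a \<in> actions G i \<Longrightarrow> pmf (\<beta> i (t i)) a = y (i, t i, a)"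
    and others: "\<And>j a. j \<in> players G - {i} \<Longrightarrow> a \<in> actions G j \<Longrightarrow> pmf (\<beta> j (t j)) a = x (j, t j, a)"
  shows "random_loss G i \<beta> t = deviation_loss G i x y t"
  unfolding random_loss_def deviation_loss_def
proof (intro sum.cong refl arg_cong2[of _ _ _ _ "(*)"])
  fix a assume "a \<in> action_profiles G"
  then have a: "a j \<in> actions G j" if "j \<in> players G" for j
    using that by (auto simp: action_profiles_def)
  show "(\<Prod>j\<in>players G. pmf (\<beta> j (t j)) (a j)) =
      y (i, t i, a i) * (\<Prod>j\<in>players G - {i}. x (j, t j, a j))"
    unfolding prod.remove[OF players_finite i]
    by (intro arg_cong2[of _ _ _ _ "(*)"] prod.cong own others a i) auto
qed

text \<open>Each product contains exactly one factor from the own strategy, so the loss is linear in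
  it.\<close>

lemma deviation_loss_convex_combination:
  assumes "i \<in> players G" "t \<in> type_profiles G"
  shows "deviation_loss G i x (\<lambda>k\<in>mixed_index G. (1 - r) * y k + r * z k) t =
    (1 - r) * deviation_loss G i x y t + r * deviation_loss G i x z t"
  unfolding deviation_loss_def sum_distrib_left sum.distrib[symmetric]
proof (intro sum.cong refl)
  fix a assume "a \<in> action_profiles G"
  then have "(i, t i, a i) \<in> mixed_index G"
    using assms by (auto simp: action_profiles_def type_profiles_def mixed_index_def)
  then show "loss G i t a * ((\<lambda>k\<in>mixed_index G. (1 - r) * y k + r * z k) (i, t i, a i) *
        (\<Prod>j\<in>players G - {i}. x (j, t j, a j))) =
      (1 - r) * (loss G i t a * (y (i, t i, a i) * (\<Prod>j\<in>players G - {i}. x (j, t j, a j)))) +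
      r * (loss G i t a * (z (i, t i, a i) * (\<Prod>j\<in>players G - {i}. x (j, t j, a j))))"
    by (simp add: algebra_simps)
qed

lemma continuous_on_deviation_loss:
  "continuous_on S (\<lambda>(x, y). deviation_loss G i x y t)"
  unfolding deviation_loss_def case_prod_beta
  by (intro continuous_intros continuous_on_product_then_coordinatewise[OF continuous_on_fst]
      continuous_on_product_then_coordinatewise[OF continuous_on_snd] continuous_on_id)

lemma deviation_loss_cong:
  assumes "i \<in> players G" and "\<And>a. a \<in> actions G i \<Longrightarrow> y (i, t i, a) = z (i, t i, a)"
  shows "deviation_loss G i x y t = deviation_loss G i x z t"
  unfolding deviation_loss_def
  using assms by (intro sum.cong refl) (auto simp: action_profiles_def)

text \<open>The switch happens at type \<open>s\<close> only, whereas \<open>deviate\<close>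
  switches at every type. Within the cell of \<open>s\<close> the two agree.\<close>

definition play_pure ::
    "('t, 'a) game \<Rightarrow> nat \<Rightarrow> 't \<Rightarrow> 'a \<Rightarrow> (nat \<times> 't \<times> 'a \<Rightarrow> real) \<Rightarrow> nat \<times> 't \<times> 'a \<Rightarrow> real" where
  "play_pure G i s a x = (\<lambda>(j, r, b)\<in>mixed_index G.
     if j = i \<and> r = s then (if b = a then 1 else 0) else x (j, r, b))"

lemma play_pure_in_mixed_profiles:
  assumes G: "risk_averse_game G" and x: "x \<in> mixed_profiles G"
    and "i \<in> players G" "a \<in> actions G i"
  shows "play_pure G i s a x \<in> mixed_profiles G"
proof -
  have "(\<Sum>b\<in>actions G j. play_pure G i s a x (j, r, b)) = 1"
    if jr: "j \<in> players G" "r \<in> types G j" for j r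
  proof -
    have "finite (actions G j)" using G jr by (simp add: risk_averse_game_def)
    moreover have "(\<Sum>b\<in>actions G j. play_pure G i s a x (j, r, b)) =
        (\<Sum>b\<in>actions G j. if j = i \<and> r = s then (if b = a then 1 else 0) else x (j, r, b))"
      using jr by (intro sum.cong) (auto simp: play_pure_def mixed_index_def)
    ultimately show ?thesis
      using jr x assms(4) by (cases "j = i \<and> r = s") (auto simp: mixed_profiles_def)
  qed
  moreover have "play_pure G i s a x \<in> PiE (mixed_index G) (\<lambda>_. {0..1})"
    using x by (auto simp: play_pure_def mixed_profiles_def PiE_iff)
  ultimately show ?thesis by (simp add: mixed_profiles_def)
qed

section \<open>Total risk and its separation over players and types\<close>

definition player_types :: "('t, 'a) game \<Rightarrow> (nat \<times> 't) set" where
  "player_types G = (SIGMA i:players G. types G i)"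

definition cell_risk ::
    "('t, 'a) game \<Rightarrow> (nat \<times> 't \<Rightarrow> ((nat \<Rightarrow> 't) \<Rightarrow> real) set) \<Rightarrow>
     (nat \<times> 't \<times> 'a \<Rightarrow> real) \<Rightarrow> (nat \<times> 't \<times> 'a \<Rightarrow> real) \<Rightarrow> nat \<times> 't \<Rightarrow> real" where
  "cell_risk G Q x y = (\<lambda>(i, s).
     worst_mean {t \<in> type_profiles G. t i = s} (Q (i, s)) (deviation_loss G i x y))"

definition total_risk ::
    "('t, 'a) game \<Rightarrow> (nat \<times> 't \<Rightarrow> ((nat \<Rightarrow> 't) \<Rightarrow> real) set) \<Rightarrow>
     (nat \<times> 't \<times> 'a \<Rightarrow> real) \<Rightarrow> (nat \<times> 't \<times> 'a \<Rightarrow> real) \<Rightarrow> real" where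
  "total_risk G Q x y = sum (cell_risk G Q x y) (player_types G)"

definition interim_weights ::
    "('t, 'a) game \<Rightarrow> (nat \<times> 't \<Rightarrow> ((nat \<Rightarrow> 't) \<Rightarrow> real) set) \<Rightarrow> bool" where
  "interim_weights G Q \<longleftrightarrow> (\<forall>(i, s)\<in>player_types G.
     Q (i, s) \<noteq> {} \<and> Q (i, s) \<subseteq> prob_weights {t \<in> type_profiles G. t i = s})"

lemma finite_player_types: "risk_averse_game G \<Longrightarrow> finite (player_types G)"
  unfolding player_types_def
  by (intro finite_SigmaI) (simp_all add: risk_averse_game_def players_def)

text \<open>Deviation losses are linear in the own strategy, and worst-case means are convex in the
  loss.\<close>

lemma total_risk_convex:
  assumes G: "risk_averse_game G" and Q: "interim_weights G Q" and r: "r \<in> {0..1}"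
  shows "total_risk G Q x (\<lambda>k\<in>mixed_index G. (1 - r) * y k + r * z k) \<le>
    (1 - r) * total_risk G Q x y + r * total_risk G Q x z"
  unfolding total_risk_def sum_distrib_left sum.distrib[symmetric]
proof (rule sum_mono)
  fix k assume k: "k \<in> player_types G"
  obtain i s where ks: "k = (i, s)" by (cases k)
  let ?A = "{t \<in> type_profiles G. t i = s}"
  have i: "i \<in> players G" using k by (simp add: ks player_types_def)
  have w: "finite ?A" "Q (i, s) \<subseteq> prob_weights ?A" "Q (i, s) \<noteq> {}"
    using finite_type_profiles[OF G] Q k by (auto simp: interim_weights_def ks)
  have "cell_risk G Q x (\<lambda>k\<in>mixed_index G. (1 - r) * y k + r * z k) k =
      worst_mean ?A (Q (i, s))
        (\<lambda>t. (1 - r) * deviation_loss G i x y t + r * deviation_loss G i x z t)"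
    unfolding cell_risk_def ks prod.case
    by (rule worst_mean_cong, rule deviation_loss_convex_combination[OF i]) simp
  also have "\<dots> \<le> (1 - r) * cell_risk G Q x y k + r * cell_risk G Q x z k"
    unfolding cell_risk_def ks prod.case by (rule worst_mean_convex[OF w r])
  finally show "cell_risk G Q x (\<lambda>k\<in>mixed_index G. (1 - r) * y k + r * z k) k \<le>
      (1 - r) * cell_risk G Q x y k + r * cell_risk G Q x z k" .
qed

lemma continuous_on_total_risk:
  assumes G: "risk_averse_game G" and Q: "interim_weights G Q"
  shows "continuous_on S (\<lambda>(x, y). total_risk G Q x y)"
  unfolding total_risk_def case_prod_beta
proof (rule continuous_on_sum)
  fix k assume k: "k \<in> player_types G"
  obtain i s where ks: "k = (i, s)" by (cases k)
  have "continuous_on S (\<lambda>p. worst_mean {t \<in> type_profiles G. t i = s} (Q (i, s))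
      (deviation_loss G i (fst p) (snd p)))"
    using finite_type_profiles[OF G] Q k
    by (intro continuous_on_worst_mean continuous_on_deviation_loss[unfolded case_prod_beta])
      (auto simp: interim_weights_def ks)
  then show "continuous_on S (\<lambda>p. cell_risk G Q (fst p) (snd p) k)"
    by (simp add: cell_risk_def ks)
qed

lemma total_risk_equilibrium:
  assumes G: "risk_averse_game G" and Q: "interim_weights G Q"
  shows "\<exists>x\<in>mixed_profiles G. \<forall>y\<in>mixed_profiles G. total_risk G Q x x \<le> total_risk G Q x y"
proof -
  have sub: "mixed_profiles G \<subseteq> PiE (mixed_index G) (\<lambda>_. {0..1})"
    by (auto simp: mixed_profiles_def)
  show ?thesis
  proof (rule ky_fan_equilibrium[OF finite_mixed_index[OF G] sub compact_mixed_profiles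
        mixed_profiles_nonempty[OF G] mixed_profiles_convex continuous_on_total_risk[OF G Q]
        total_risk_convex[OF G Q]])
    fix x
    assume "x \<in> mixed_profiles G"
      "\<And>y. y \<in> mixed_profiles G \<Longrightarrow> total_risk G Q x x \<le> total_risk G Q x y"
    then show ?thesis by (intro bexI[of _ x] ballI)
  qed
qed

text \<open>The risk at \<open>(j, r)\<close> depends on the second profile only through the
  coordinates \<open>(j, r, b)\<close>, which the switch leaves alone.\<close>

lemma cell_risk_play_pure:
  assumes "k \<in> player_types G" "k \<noteq> (i, s)"
  shows "cell_risk G Q x (play_pure G i s a x) k = cell_risk G Q x x k"
proof -
  obtain j r where k: "k = (j, r)" by (cases k)
  have jr: "j \<in> players G" "r \<in> types G j" "(j, r) \<noteq> (i, s)"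
    using assms by (auto simp: k player_types_def)
  show ?thesis
    unfolding cell_risk_def k prod.case
    by (intro worst_mean_cong deviation_loss_cong jr)
      (use jr in \<open>auto simp: play_pure_def mixed_index_def\<close>)
qed

text \<open>All summands but the one at \<open>(i, s)\<close> cancel, so optimality of the total
  localizes to a single type.\<close>

lemma cell_risk_le_play_pure:
  assumes G: "risk_averse_game G" and is': "(i, s) \<in> player_types G"
    and le: "total_risk G Q x x \<le> total_risk G Q x (play_pure G i s a x)"
  shows "cell_risk G Q x x (i, s) \<le> cell_risk G Q x (play_pure G i s a x) (i, s)"
proof -
  have "sum (cell_risk G Q x (play_pure G i s a x)) (player_types G - {(i, s)}) =
      sum (cell_risk G Q x x) (player_types G - {(i, s)})"
    by (intro sum.cong refl cell_risk_play_pure) auto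
  then show ?thesis
    using le unfolding total_risk_def sum.remove[OF finite_player_types[OF G] is'] by simp
qed

lemma cell_risk_random_loss:
  assumes G: "risk_averse_game G" and x: "x \<in> mixed_profiles G" and i: "i \<in> players G"
  shows "worst_mean {t \<in> type_profiles G. t i = s} (Q (i, s)) (random_loss G i (profile_of G x)) =
    cell_risk G Q x x (i, s)"
  unfolding cell_risk_def prod.case
proof (intro worst_mean_cong random_loss_eq_deviation_loss i)
  fix t j a
  assume "t \<in> {t \<in> type_profiles G. t i = s}"
  then have t: "t j \<in> types G j" if "j \<in> players G" for j
    using that by (auto simp: type_profiles_def)
  show "pmf (profile_of G x i (t i)) a = x (i, t i, a)" if "a \<in> actions G i"
    using that by (simp add: pmf_profile_of[OF G x i t[OF i]])
  show "pmf (profile_of G x j (t j)) a = x (j, t j, a)" if "j \<in> players G - {i}" "a \<in> actions G j"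
    using that by (simp add: pmf_profile_of[OF G x _ t])
qed

text \<open>Only type profiles with \<open>t i = s\<close> enter, so what \<open>deviate\<close>
  does at other types is invisible.\<close>

lemma cell_risk_random_loss_deviate:
  assumes G: "risk_averse_game G" and x: "x \<in> mixed_profiles G"
    and i: "i \<in> players G" and s: "s \<in> types G i"
  shows "worst_mean {t \<in> type_profiles G. t i = s} (Q (i, s))
      (random_loss G i (deviate G i a (profile_of G x))) =
    cell_risk G Q x (play_pure G i s a x) (i, s)"
  unfolding cell_risk_def prod.case
proof (intro worst_mean_cong random_loss_eq_deviation_loss i)
  fix t j b
  assume ts: "t \<in> {t \<in> type_profiles G. t i = s}"
  then have t: "t j \<in> types G j" if "j \<in> players G" for j
    using that by (auto simp: type_profiles_def)
  show "pmf (deviate G i a (profile_of G x) i (t i)) b = play_pure G i s a x (i, t i, b)"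
    if "b \<in> actions G i"
    using that ts i s by (auto simp: deviate_def play_pure_def mixed_index_def indicator_def)
  show "pmf (deviate G i a (profile_of G x) j (t j)) b = x (j, t j, b)"
    if "j \<in> players G - {i}" "b \<in> actions G j"
    using that by (simp add: deviate_def pmf_profile_of[OF G x _ t])
qed

theorem revised_equilibrium_exists:
  assumes G: "risk_averse_game G"
    and Z: "\<And>i. i \<in> players G \<Longrightarrow>
      admissible_dual (prior G) (interim_info G i) (risk_pref G i) (Z i)"
  shows "\<exists>\<beta>. revised_equilibrium G Z \<beta>"
proof -
  define good where "good = (\<lambda>(i, s) q. q \<noteq> {} \<and> q \<subseteq> prob_weights {t \<in> type_profiles G. t i = s} \<and>
      (\<forall>L. interim_risk G i (Z i) L s = worst_mean {t \<in> type_profiles G. t i = s} q L))"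
  have "\<exists>q. good (i, s) q" if "(i, s) \<in> player_types G" for i s
  proof -
    have i: "i \<in> players G" and s: "s \<in> types G i"
      using that by (simp_all add: player_types_def)
    show ?thesis
    proof (rule interim_risk_worst_mean[OF G i Z[OF i] s])
      fix q
      assume "q \<noteq> {}" "q \<subseteq> prob_weights {t \<in> type_profiles G. t i = s}"
        "\<And>L. interim_risk G i (Z i) L s = worst_mean {t \<in> type_profiles G. t i = s} q L"
      then show ?thesis by (intro exI[of _ q]) (simp add: good_def)
    qed
  qed
  then have "\<forall>k\<in>player_types G. \<exists>q. good k q" by (simp add: split_paired_all)
  \<comment> \<open>One weight set per player and type is fixed here, before any strategy profile is
    considered.\<close>
  then obtain Q where good: "\<forall>k\<in>player_types G. good k (Q k)"
    by (rule bchoice[THEN exE])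
  then have Q: "interim_weights G Q"
    by (auto simp: interim_weights_def good_def)
  have risk: "interim_risk G i (Z i) L s = worst_mean {t \<in> type_profiles G. t i = s} (Q (i, s)) L"
    if "(i, s) \<in> player_types G" for i s L
    using bspec[OF good that] by (simp add: good_def)
  obtain x where x: "x \<in> mixed_profiles G"
    and opt: "\<forall>y\<in>mixed_profiles G. total_risk G Q x x \<le> total_risk G Q x y"
    using total_risk_equilibrium[OF G Q] by blast
  have "interim_risk G i (Z i) (random_loss G i (profile_of G x)) s
      \<le> interim_risk G i (Z i) (random_loss G i (deviate G i a (profile_of G x))) s"
    if i: "i \<in> players G" and s: "s \<in> types G i" and a: "a \<in> actions G i" for i s a
  proof -
    have is': "(i, s) \<in> player_types G" using i s by (simp add: player_types_def)
    show ?thesis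
      unfolding risk[OF is'] cell_risk_random_loss[OF G x i] cell_risk_random_loss_deviate[OF G x i s]
      by (intro cell_risk_le_play_pure G is' opt[rule_format] play_pure_in_mixed_profiles x i a)
  qed
  then show ?thesis
    using profile_of_in_strategy_profiles[OF G x] unfolding revised_equilibrium_def by blast
qed

text \<open>\<open>\<beta>\<close> fixes the dual variables \<open>Z \<beta>\<close>; the
  equilibrium \<open>\<beta>'\<close> for them may be a different profile.\<close>

theorem corollary1:
  fixes G :: "('t, 'a) game"
    and \<beta> :: "('t, 'a) profile"
    and Z :: "('t, 'a) profile \<Rightarrow> nat \<Rightarrow> (nat \<Rightarrow> 't) \<Rightarrow> real"
  assumes "risk_averse_game G"
    and "\<And>i. i \<in> players G \<Longrightarrow> coherent_risk_measure (prior G) (risk_pref G i)"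
    and "\<And>i. i \<in> players G \<Longrightarrow> law_invariant (prior G) (risk_pref G i)"
    and "\<beta> \<in> strategy_profiles G"
    and "\<And>i. i \<in> players G \<Longrightarrow>
           admissible_dual (prior G) (interim_info G i) (risk_pref G i) (Z \<beta> i)"
  shows "\<exists>\<beta>'. revised_equilibrium G (Z \<beta>) \<beta>'"
  using revised_equilibrium_exists[OF assms(1,5)] .

end
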